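(* Let $n\ge 2$, let $\mathbf a,\mathbf b\in\mathbb R^n$ have strictly positive entries with $\alpha=\sum_i\mathbf a_i$, $\beta=\sum_j\mathbf b_j$, let $C\in\mathbb R^{n\times n}$ have nonnegative entries, and let $\tau>0$. Let $\varepsilon>0$, $\eta=\varepsilon/U$, and let $(u^k,v^k)$ be the unbalanced Sinkhorn iterates defined below. If $$k\ge 1+\Big(\frac{\tau U}{\varepsilon}+1\Big)\Big[\log(8\eta R)+\log(\tau(\tau+1))+3\log\Big(\frac U\varepsilon\Big)\Big],$$ then $X^k=B(u^k,v^k)$ is an $\varepsilon$-approximation transportation plan, i.e. $f(X^k)\le f(\widehat X)+\varepsilon$, where $\widehat X$ is a minimizer of $f$ over nonnegative $n\times n$ matrices.
   Context: Logarithms are natural and applied entrywise; $\mathbf 1_n$ is the all-ones vector; $\|C\|_\infty=\max_{i,j}|C_{ij}|$. For nonnegative vectors, $\mathbf{KL}(x\|y)=\sum_i x_i\log(x_i/y_i)-x_i+y_i$ (with $0\log 0=0$). For a nonnegative $n\times n$ matrix $X$, $f(X)=\langle C,X\rangle+\tau\,\mathbf{KL}(X\mathbf 1_n\|\mathbf a)+\tau\,\mathbf{KL}(X^\top\mathbf 1_n\|\mathbf b)$ (the unbalanced optimal transport objective), where $\langle C,X\rangle=\sum_{ij}C_{ij}X_{ij}$. For $u,v\in\mathbb R^n$, $B(u,v)_{ij}=\exp((u_i+v_j-C_{ij})/\eta)$. The Sinkhorn iterates: $u^0=v^0=0$; with $a^k=B(u^k,v^k)\mathbf 1_n$, $b^k=B(u^k,v^k)^\top\mathbf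 1_n$, if $k$ is even then $u^{k+1}=\frac{\eta\tau}{\eta+\tau}[\frac{u^k}{\eta}+\log\mathbf a-\log a^k]$, $v^{k+1}=v^k$; if $k$ is odd then $v^{k+1}=\frac{\eta\tau}{\eta+\tau}[\frac{v^k}{\eta}+\log\mathbf b-\log b^k]$, $u^{k+1}=u^k$. Constants: $R=\max\{\|\log\mathbf a\|_\infty,\|\log\mathbf b\|_\infty\}+\max\{\log n,\ \frac1\eta\|C\|_\infty-\log n\}$; $S=\frac12(\alpha+\beta)+\frac12+\frac1{4\log n}$; $T=\frac{\alpha+\beta}2[\log\frac{\alpha+\beta}2+2\log n-1]+\log n+\frac52$; $U=\max\{S+T,\,2\varepsilon,\,\frac{4\varepsilon\log n}\tau,\,\frac{4\varepsilon(\alpha+\beta)\log n}\tau\}$. *)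

theory Defs
  imports "HOL-Analysis.Analysis"
begin

definition vlog :: "real^'n \<Rightarrow> real^'n" where
  "vlog x = (\<chi> i. ln (x $ i))"

definition max_norm :: "real^'n^'m \<Rightarrow> real" where
  "max_norm C = Max {\<bar>C $ i $ j\<bar> | i j. True}"

text \<open>The convention \<open>0 log 0 = 0\<close> is automatic, since the logarithm is multiplied by
  \<open>x $ i\<close>. The definition is only meant for \<open>x\<close> with nonnegative and \<open>y\<close> with
  strictly positive entries, so the value \<open>\<infinity>\<close> is never needed.\<close>

definition KL :: "real^'n \<Rightarrow> real^'n \<Rightarrow> real" where
  "KL x y = (\<Sum>i\<in>UNIV. x $ i * ln (x $ i / y $ i) - x $ i + y $ i)"

definition nonneg_mat :: "real^'n^'m \<Rightarrow> bool" where
  "nonneg_mat X \<longleftrightarrow> (\<forall>i j. 0 \<le> X $ i $ j)"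

text \<open>Below, \<open>vec 1\<close> is the all-ones vector, and \<open>C \<bullet> X\<close> on matrices is the sum of
  the entrywise products.\<close>

definition uot_objective ::
  "real^'n^'n \<Rightarrow> real^'n \<Rightarrow> real^'n \<Rightarrow> real \<Rightarrow> real^'n^'n \<Rightarrow> real" where
  "uot_objective C a b \<tau> X =
     C \<bullet> X + \<tau> * KL (X *v vec 1) a + \<tau> * KL (transpose X *v vec 1) b"

definition sinkhorn_plan ::
  "real^'n^'n \<Rightarrow> real \<Rightarrow> real^'n \<Rightarrow> real^'n \<Rightarrow> real^'n^'n" where
  "sinkhorn_plan C \<eta> u v = (\<chi> i j. exp ((u $ i + v $ j - C $ i $ j) / \<eta>))"

primrec sinkhorn ::
  "real^'n^'n \<Rightarrow> real^'n \<Rightarrow> real^'n \<Rightarrow> real \<Rightarrow> real \<Rightarrow> nat \<Rightarrow> (real^'n) \<times> (real^'n)" where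
  "sinkhorn C a b \<tau> \<eta> 0 = (0, 0)"
| "sinkhorn C a b \<tau> \<eta> (Suc k) =
     (let (u, v) = sinkhorn C a b \<tau> \<eta> k;
          ak = sinkhorn_plan C \<eta> u v *v vec 1;
          bk = transpose (sinkhorn_plan C \<eta> u v) *v vec 1
      in if even k
         then ((\<eta> * \<tau> / (\<eta> + \<tau>)) *\<^sub>R (u /\<^sub>R \<eta> + vlog a - vlog ak), v)
         else (u, (\<eta> * \<tau> / (\<eta> + \<tau>)) *\<^sub>R (v /\<^sub>R \<eta> + vlog b - vlog bk)))"

definition R_const :: "real^'n^'n \<Rightarrow> real^'n \<Rightarrow> real^'n \<Rightarrow> real \<Rightarrow> real" where
  "R_const C a b \<eta> =
     max (infnorm (vlog a)) (infnorm (vlog b))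
     + max (ln (real CARD('n))) (1 / \<eta> * max_norm C - ln (real CARD('n)))"

definition S_const :: "nat \<Rightarrow> real \<Rightarrow> real \<Rightarrow> real" where
  "S_const n \<alpha> \<beta> = 1 / 2 * (\<alpha> + \<beta>) + 1 / 2 + 1 / (4 * ln (real n))"

definition T_const :: "nat \<Rightarrow> real \<Rightarrow> real \<Rightarrow> real" where
  "T_const n \<alpha> \<beta> =
     (\<alpha> + \<beta>) / 2 * (ln ((\<alpha> + \<beta>) / 2) + 2 * ln (real n) - 1) + ln (real n) + 5 / 2"

definition U_const :: "nat \<Rightarrow> real \<Rightarrow> real \<Rightarrow> real \<Rightarrow> real \<Rightarrow> real" where
  "U_const n \<alpha> \<beta> \<tau> \<epsilon> =
     Max {S_const n \<alpha> \<beta> + T_const n \<alpha> \<beta>,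
          2 * \<epsilon>,
          4 * \<epsilon> * ln (real n) / \<tau>,
          4 * \<epsilon> * (\<alpha> + \<beta>) * ln (real n) / \<tau>}"

end

theory Submission
  imports Defs
begin

text \<open>
  Let \<open>g = f - \<eta> H\<close> be the entropically regularized objective. One half step of the iteration
  depends only on the other potential, contracts the sup norm by \<open>\<tau> / (\<eta> + \<tau>)\<close>, and maps the cube
  of radius \<open>\<tau> R\<close> into itself; Brouwer's theorem thus yields a fixed point \<open>(u*, v*)\<close> in that cube,
  and after \<open>k\<close> steps the potentials are within \<open>\<eta>\<^sup>2 / (8 (\<tau> + 1))\<close> of it. At the plan \<open>X*\<close> of the
  fixed point \<open>u* = - \<tau> log (X* 1 / a)\<close> and \<open>v* = - \<tau> log (X*\<^sup>T 1 / b)\<close>, so bounding every \<open>x log x\<close>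
  in \<open>g\<close> by its tangent at \<open>X*\<close> gives \<open>g X \<ge> g X* = \<tau> (\<alpha> + \<beta>) - (2 \<tau> + \<eta>) |X*|\<close>, where \<open>|X|\<close> is
  the total mass. Closeness of the potentials gives \<open>|X\<^sup>k| \<le> S\<close> and \<open>g X\<^sup>k - g X* \<le> \<eta> S\<close>, while
  \<open>H X\<^sup>k - H Xhat \<le> T\<close> because the entropy of a plan is controlled by its mass and the mass of the
  minimizer is at most \<open>(\<alpha> + \<beta>) / 2\<close>. Hence \<open>f X\<^sup>k - f Xhat \<le> \<eta> (S + T) \<le> \<epsilon>\<close>.
\<close>

section \<open>Scalar estimates for x ln x - x\<close>

text \<open>By convexity, x ln x - x lies above its tangent at y, whose value at x is x ln y -
  y.\<close>

lemma gibbs_pointwise: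
  fixes x y :: real
  assumes "0 \<le> x" "0 < y"
  shows "x * ln y - y \<le> x * ln x - x"
proof (cases "x = 0")
  case False
  with assms have x: "0 < x" by simp
  have "ln (y / x) \<le> y / x - 1"
    using x assms by (intro ln_le_minus_one) auto
  then have "x * ln (y / x) \<le> x * (y / x - 1)"
    using x by (intro mult_left_mono) auto
  then show ?thesis
    using x assms by (simp add: ln_div algebra_simps)
qed (use assms in auto)

lemma xlnx_minus_x_ge:
  fixes x :: real
  assumes "0 \<le> x"
  shows "- 1 \<le> x * ln x - x"
  using gibbs_pointwise[of x 1] assms by simp

text \<open>The function x ln x - x falls from 0 at 0 to -1 at 1 and increases afterwards, so it
  fails to be monotone by at most 1. This 1 is one of the summands of the constant 5/2 in
  \<open>T_const\<close>.\<close>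

lemma xlnx_minus_x_le_of_le:
  fixes x y :: real
  assumes "0 \<le> x" "x \<le> y"
  shows "x * ln x - x \<le> y * ln y - y + 1"
proof (cases "1 \<le> y")
  case True
  show ?thesis
  proof (cases "x = 0")
    case False
    with assms True have "x * ln x \<le> x * ln y" by (intro mult_left_mono) auto
    moreover have "x * (ln y - 1) \<le> y * ln y - y + 1"
    proof (cases "1 \<le> ln y")
      case True
      then have "x * (ln y - 1) \<le> y * (ln y - 1)" using assms by (intro mult_right_mono) auto
      then show ?thesis by (simp add: algebra_simps)
    next
      case False
      then have "x * (ln y - 1) \<le> 0" using assms by (intro mult_nonneg_nonpos) auto
      then show ?thesis using xlnx_minus_x_ge[of y] assms by simp
    qed
    ultimately show ?thesis by (simp add: algebra_simps)
  qed (use xlnx_minus_x_ge[of y] assms in simp)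
next
  case False
  have "x * ln x \<le> 0"
    using assms False by (cases "x = 0") (auto intro!: mult_nonneg_nonpos)
  moreover have "- 1 \<le> y * ln y - y" using xlnx_minus_x_ge[of y] assms by simp
  ultimately show ?thesis using assms by simp
qed

section \<open>Mass, entropy and marginals of a plan\<close>

definition mass :: "real^'n^'m \<Rightarrow> real" where
  "mass X = (\<Sum>i\<in>UNIV. \<Sum>j\<in>UNIV. X $ i $ j)"

text \<open>The linear term makes the derivative in each entry exactly the logarithm, so stationary
  points of the regularized objective have the exponential form of
  \<open>sinkhorn_plan\<close>.\<close>

definition neg_entropy :: "real^'n^'m \<Rightarrow> real" where
  "neg_entropy X = (\<Sum>i\<in>UNIV. \<Sum>j\<in>UNIV. X $ i $ j * ln (X $ i $ j) - X $ i $ j)"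

definition row_sums :: "real^'n^'m \<Rightarrow> real^'m" where
  "row_sums X = (\<chi> i. \<Sum>j\<in>UNIV. X $ i $ j)"

definition col_sums :: "real^'n^'m \<Rightarrow> real^'n" where
  "col_sums X = (\<chi> j. \<Sum>i\<in>UNIV. X $ i $ j)"

lemma matrix_mult_ones: "X *v vec 1 = row_sums X" "transpose X *v vec 1 = col_sums X"
  by (simp_all only: matrix_vector_mult_def transpose_def row_sums_def col_sums_def vec_component
      vec_lambda_beta mult_1_right)

lemma mass_row_sums: "mass X = sum (($) (row_sums X)) UNIV"
  by (simp add: mass_def row_sums_def)

lemma mass_col_sums: "mass X = sum (($) (col_sums X)) UNIV"
  unfolding mass_def col_sums_def by (simp, rule sum.swap)

lemma sum_mult_row_sums:
  "(\<Sum>i\<in>UNIV. \<Sum>j\<in>UNIV. X $ i $ j * w i) = (\<Sum>i\<in>UNIV. row_sums X $ i * w i)"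
  by (simp add: row_sums_def sum_distrib_right)

lemma sum_mult_col_sums:
  "(\<Sum>i\<in>UNIV. \<Sum>j\<in>UNIV. X $ i $ j * w j) = (\<Sum>j\<in>UNIV. col_sums X $ j * w j)"
  unfolding col_sums_def by (simp add: sum_distrib_right, rule sum.swap)

lemma sums_nonneg:
  assumes "nonneg_mat X"
  shows "0 \<le> row_sums X $ i" "0 \<le> col_sums X $ j"
  using assms by (simp_all add: nonneg_mat_def row_sums_def col_sums_def sum_nonneg)

lemma mass_nonneg: "nonneg_mat X \<Longrightarrow> 0 \<le> mass X"
  by (simp add: mass_def nonneg_mat_def sum_nonneg)

text \<open>No entry exceeds the total mass, so each logarithm may be replaced by that of the
  mass.\<close>

lemma neg_entropy_le:
  fixes X :: "real^'n^'m"
  assumes "nonneg_mat X"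
  shows "neg_entropy X \<le> mass X * ln (mass X) - mass X"
proof -
  have "X $ i $ j * ln (X $ i $ j) \<le> X $ i $ j * ln (mass X)" for i j
  proof (cases "X $ i $ j = 0")
    case False
    with assms have pos: "0 < X $ i $ j" by (simp add: nonneg_mat_def less_le)
    have "X $ i $ j \<le> (\<Sum>j\<in>UNIV. X $ i $ j)"
      using assms by (intro member_le_sum) (auto simp: nonneg_mat_def)
    also have "\<dots> \<le> mass X"
      unfolding mass_def using assms
      by (intro member_le_sum[where f = "\<lambda>i. \<Sum>j\<in>UNIV. X $ i $ j"])
         (auto simp: nonneg_mat_def sum_nonneg)
    finally show ?thesis using pos by (intro mult_left_mono) auto
  qed simp
  then have "neg_entropy X \<le> (\<Sum>i\<in>UNIV. \<Sum>j\<in>UNIV. X $ i $ j * ln (mass X) - X $ i $ j)"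
    unfolding neg_entropy_def by (intro sum_mono) (simp add: algebra_simps)
  also have "\<dots> = mass X * ln (mass X) - mass X"
    by (simp add: mass_def sum_subtractf sum_distrib_right)
  finally show ?thesis .
qed

text \<open>For a given mass the uniform plan has the largest entropy; the bound is the tangent
  inequality taken at its constant entry \<open>mass X / n^2\<close>.\<close>

lemma neg_entropy_ge:
  fixes X :: "real^'n^'n"
  assumes "nonneg_mat X" "0 < mass X"
  shows "mass X * ln (mass X) - mass X - 2 * mass X * ln (real CARD('n)) \<le> neg_entropy X"
proof -
  define y where "y = mass X / (real CARD('n))\<^sup>2"
  have y: "0 < y" using assms by (simp add: y_def)
  have "(\<Sum>i\<in>UNIV. \<Sum>j\<in>UNIV. X $ i $ j * ln y - y) \<le> neg_entropy X"
    unfolding neg_entropy_def using assms(1) y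
    by (intro sum_mono gibbs_pointwise) (auto simp: nonneg_mat_def)
  moreover have "(\<Sum>i\<in>UNIV. \<Sum>j\<in>UNIV. X $ i $ j * ln y - y)
      = mass X * ln y - real CARD('n) * (real CARD('n) * y)"
    by (simp add: mass_def sum_subtractf sum_distrib_right)
  moreover have "real CARD('n) * (real CARD('n) * y) = mass X"
    by (simp add: y_def power2_eq_square)
  moreover have "ln y = ln (mass X) - 2 * ln (real CARD('n))"
    using assms by (simp add: y_def ln_div ln_realpow)
  ultimately show ?thesis by (simp add: algebra_simps)
qed

section \<open>Convexity and scaling of the KL divergence\<close>

lemma KL_nonneg:
  assumes "\<And>i. 0 \<le> x $ i" "\<And>i. 0 < y $ i"
  shows "0 \<le> KL x y"
  unfolding KL_def
proof (intro sum_nonneg)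
  fix i
  show "0 \<le> x $ i * ln (x $ i / y $ i) - x $ i + y $ i"
    using gibbs_pointwise[of "x $ i" "y $ i"] assms(1)[of i] assms(2)[of i]
    by (cases "x $ i = 0") (auto simp: ln_div algebra_simps)
qed

lemma KL_ge_tangent:
  assumes "\<And>i. 0 \<le> x $ i" "\<And>i. 0 < y $ i" "\<And>i. 0 < z $ i"
  shows "(\<Sum>i\<in>UNIV. x $ i * ln (z $ i / y $ i) - z $ i + y $ i) \<le> KL x y"
  unfolding KL_def
proof (intro sum_mono)
  fix i
  show "x $ i * ln (z $ i / y $ i) - z $ i + y $ i \<le> x $ i * ln (x $ i / y $ i) - x $ i + y $ i"
    using gibbs_pointwise[of "x $ i" "z $ i"] assms(1)[of i] assms(2)[of i] assms(3)[of i]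
    by (cases "x $ i = 0") (auto simp: ln_div algebra_simps)
qed

text \<open>The dependence on \<open>t\<close> is reduced to \<open>t\<close> and
  \<open>t ln t - t\<close>, ready for differentiating the objective along a ray.\<close>

lemma KL_scaleR:
  assumes "0 < t" "\<And>i. 0 \<le> x $ i" "\<And>i. 0 < y $ i"
  shows "KL (t *\<^sub>R x) y =
    t * (KL x y + (\<Sum>i\<in>UNIV. x $ i) - (\<Sum>i\<in>UNIV. y $ i))
      + (t * ln t - t) * (\<Sum>i\<in>UNIV. x $ i) + (\<Sum>i\<in>UNIV. y $ i)"
proof -
  have "t * x $ i * ln (t * x $ i / y $ i) = t * (x $ i * ln (x $ i / y $ i)) + t * ln t * x $ i" for i
    using assms(1) assms(2)[of i] assms(3)[of i]
    by (cases "x $ i = 0") (auto simp: ln_mult ln_div algebra_simps)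
  then show ?thesis
    unfolding KL_def
    by (simp add: sum.distrib sum_subtractf sum_distrib_left[symmetric] algebra_simps)
qed

section \<open>The objective and the mass of its minimizer\<close>

locale unbalanced_ot =
  fixes C :: "real^'n^'n" and a b :: "real^'n" and \<tau> :: real
  assumes C_nonneg: "0 \<le> C $ i $ j"
    and a_pos: "0 < a $ i" and b_pos: "0 < b $ j"
    and \<tau>_pos: "0 < \<tau>"
begin

lemma uot_objective_eq:
  "uot_objective C a b \<tau> X = C \<bullet> X + \<tau> * KL (row_sums X) a + \<tau> * KL (col_sums X) b"
  unfolding uot_objective_def matrix_mult_ones(2) by (simp only: matrix_mult_ones(1))

lemma uot_objective_nonneg:
  assumes "nonneg_mat X"
  shows "0 \<le> uot_objective C a b \<tau> X"
proof -
  have "0 \<le> C \<bullet> X"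
    using assms C_nonneg by (simp add: inner_vec_def nonneg_mat_def sum_nonneg)
  moreover have "0 \<le> KL (row_sums X) a" "0 \<le> KL (col_sums X) b"
    using assms a_pos b_pos by (auto intro!: KL_nonneg sums_nonneg)
  ultimately show ?thesis
    unfolding uot_objective_eq using \<tau>_pos by simp
qed

text \<open>Compare the minimizer with its multiples \<open>t X\<close> for \<open>t\<close> slightly below 1.\<close>
lemma mass_minimizer_le:
  assumes "is_arg_min (uot_objective C a b \<tau>) nonneg_mat X"
  shows "mass X \<le> (sum (($) a) UNIV + sum (($) b) UNIV) / 2"
proof -
  let ?s = "sum (($) a) UNIV + sum (($) b) UNIV" and ?f = "uot_objective C a b \<tau>"
  have min: "?f X \<le> ?f Y" if "nonneg_mat Y" for Y
    using assms that by (auto simp: is_arg_min_linorder)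
  have X: "nonneg_mat X" using assms by (simp add: is_arg_min_def)
  \<comment> \<open>\<open>P\<close> is the derivative of \<open>?f (t *\<^sub>R X)\<close> at t =
    1. Minimality forces it to be at most 0, and \<open>0 \<le> ?f X\<close> turns that into the
    bound on the mass.\<close>
  define P where "P = ?f X + 2 * \<tau> * mass X - \<tau> * ?s"
  have scale: "?f (t *\<^sub>R X) = t * P + 2 * \<tau> * mass X * (t * ln t - t) + \<tau> * ?s" if "0 < t" for t
  proof -
    have "row_sums (t *\<^sub>R X) = t *\<^sub>R row_sums X" "col_sums (t *\<^sub>R X) = t *\<^sub>R col_sums X"
      by (simp_all add: row_sums_def col_sums_def vec_eq_iff sum_distrib_left)
    then show ?thesis
      unfolding uot_objective_eq P_def
      by (simp add: KL_scaleR[OF that sums_nonneg(1)[OF X] a_pos]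
          KL_scaleR[OF that sums_nonneg(2)[OF X] b_pos]
          mass_row_sums[symmetric] mass_col_sums[symmetric] algebra_simps)
  qed
  have "P \<le> 2 * \<tau> * mass X * e" if e: "0 < e" "e < 1" for e
  proof -
    define t where "t = 1 - e"
    have t: "0 < t" using e by (simp add: t_def)
    have "nonneg_mat (t *\<^sub>R X)" using X t by (simp add: nonneg_mat_def)
    from min[OF this] have "P * e \<le> 2 * \<tau> * mass X * (t * ln t - t + 1)"
      unfolding scale[OF t] by (simp add: P_def t_def algebra_simps)
    \<comment> \<open>This makes t ln t - t + 1 at most (1 - t)^2, of second order in e, so dividing
      by e leaves a bound on \<open>P\<close> that tends to 0.\<close>
    also have "t * ln t \<le> t * (t - 1)"
      using t by (intro mult_left_mono ln_le_minus_one) auto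
    then have "2 * \<tau> * mass X * (t * ln t - t + 1) \<le> 2 * \<tau> * mass X * (e * e)"
      using \<tau>_pos mass_nonneg[OF X]
      by (intro mult_left_mono) (auto simp: t_def algebra_simps)
    finally have "P * e \<le> (2 * \<tau> * mass X * e) * e" by (simp add: algebra_simps)
    then show ?thesis using e by simp
  qed
  note P = this
  have "P \<le> 0"
  proof (rule tendsto_lowerbound)
    show "((\<lambda>e. 2 * \<tau> * mass X * e) \<longlongrightarrow> 0) (at_right 0)"
      by (auto intro!: tendsto_eq_intros)
    show "\<forall>\<^sub>F e in at_right 0. P \<le> 2 * \<tau> * mass X * e"
      using P by (auto simp: eventually_at_right_field intro!: exI[of _ 1])
  qed simp
  then have "\<tau> * (2 * mass X) \<le> \<tau> * ?s"
    using uot_objective_nonneg[OF X] by (simp add: P_def)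
  then have "2 * mass X \<le> ?s" using \<tau>_pos mult_le_cancel_left_pos by blast
  then show ?thesis by simp
qed

end

section \<open>One half step as a map of the other potential\<close>

definition half_step :: "real^'n^'m \<Rightarrow> real^'m \<Rightarrow> real \<Rightarrow> real \<Rightarrow> real^'n \<Rightarrow> real^'m" where
  "half_step C a \<tau> \<eta> v =
     (\<chi> i. \<eta> * \<tau> / (\<eta> + \<tau>) * (ln (a $ i) - ln (\<Sum>j\<in>UNIV. exp ((v $ j - C $ i $ j) / \<eta>))))"

lemma sum_exp_pos: "0 < (\<Sum>j\<in>(UNIV :: 'a::finite set). exp (f j :: real))"
  by (intro sum_pos) auto

lemma row_sums_sinkhorn_plan:
  "row_sums (sinkhorn_plan C \<eta> u v) $ i =
     exp (u $ i / \<eta>) * (\<Sum>j\<in>UNIV. exp ((v $ j - C $ i $ j) / \<eta>))"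
  by (simp add: row_sums_def sinkhorn_plan_def sum_distrib_left exp_add[symmetric]
      add_divide_distrib[symmetric] diff_divide_distrib[symmetric] algebra_simps)

lemma col_sums_sinkhorn_plan:
  "col_sums (sinkhorn_plan C \<eta> u v) $ j =
     exp (v $ j / \<eta>) * (\<Sum>i\<in>UNIV. exp ((u $ i - transpose C $ j $ i) / \<eta>))"
  by (simp add: col_sums_def transpose_def sinkhorn_plan_def sum_distrib_left exp_add[symmetric]
      add_divide_distrib[symmetric] diff_divide_distrib[symmetric] algebra_simps)

text \<open>The logarithm of a row sum is u/\<eta> plus a log-sum-exp in v alone, so the old value
  of the updated potential cancels. Columns are the same computation for the transpose.\<close>

lemma sinkhorn_Suc_half_step:
  assumes "sinkhorn C a b \<tau> \<eta> k = (u, v)"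
  shows "sinkhorn C a b \<tau> \<eta> (Suc k) =
    (if even k then (half_step C a \<tau> \<eta> v, v) else (u, half_step (transpose C) b \<tau> \<eta> u))"
proof -
  have "(\<eta> * \<tau> / (\<eta> + \<tau>)) *\<^sub>R (u /\<^sub>R \<eta> + vlog a - vlog (row_sums (sinkhorn_plan C \<eta> u v)))
      = half_step C a \<tau> \<eta> v"
    by (simp add: vec_eq_iff half_step_def vlog_def row_sums_sinkhorn_plan ln_mult sum_exp_pos
        less_imp_neq[OF sum_exp_pos, symmetric] divide_inverse algebra_simps)
  moreover have "(\<eta> * \<tau> / (\<eta> + \<tau>)) *\<^sub>R (v /\<^sub>R \<eta> + vlog b - vlog (col_sums (sinkhorn_plan C \<eta> u v)))
      = half_step (transpose C) b \<tau> \<eta> u"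
    by (simp add: vec_eq_iff half_step_def vlog_def col_sums_sinkhorn_plan ln_mult sum_exp_pos
        less_imp_neq[OF sum_exp_pos, symmetric] divide_inverse algebra_simps)
  ultimately show ?thesis
    unfolding sinkhorn.simps assms matrix_mult_ones(2) Let_def case_prod_conv
    by (simp only: matrix_mult_ones(1))
qed

text \<open>Moving every coordinate by at most \<open>d\<close> changes the sum of exponentials by a
  factor of at most exp(d/\<eta>), hence its logarithm by at most d/\<eta>; the prefactor turns this
  into the contraction rate.\<close>

lemma half_step_lipschitz:
  assumes "0 < \<tau>" "0 < \<eta>" "\<And>j. \<bar>v $ j - w $ j\<bar> \<le> d"
  shows "\<bar>half_step C a \<tau> \<eta> v $ i - half_step C a \<tau> \<eta> w $ i\<bar> \<le> \<tau> / (\<eta> + \<tau>) * d"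
proof -
  define L where "L v = ln (\<Sum>j\<in>UNIV. exp ((v $ j - C $ i $ j) / \<eta>))" for v
  have L: "L v \<le> L w + d / \<eta>" if vw: "\<And>j. \<bar>v $ j - w $ j\<bar> \<le> d" for v w
  proof -
    have "(v $ j - C $ i $ j) / \<eta> \<le> d / \<eta> + (w $ j - C $ i $ j) / \<eta>" for j
      using vw[of j] \<open>0 < \<eta>\<close> by (auto simp: field_simps)
    then have "(\<Sum>j\<in>UNIV. exp ((v $ j - C $ i $ j) / \<eta>))
        \<le> exp (d / \<eta>) * (\<Sum>j\<in>UNIV. exp ((w $ j - C $ i $ j) / \<eta>))"
      unfolding sum_distrib_left exp_add[symmetric] by (intro sum_mono) simp
    then have "L v \<le> ln (exp (d / \<eta>) * (\<Sum>j\<in>UNIV. exp ((w $ j - C $ i $ j) / \<eta>)))"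
      unfolding L_def using sum_exp_pos by (intro ln_mono) (auto intro!: mult_pos_pos)
    then show ?thesis
      unfolding L_def by (simp add: ln_mult sum_exp_pos less_imp_neq[OF sum_exp_pos, symmetric])
  qed
  have "\<bar>L w - L v\<bar> \<le> d / \<eta>"
    using L[of v w] L[of w v] assms(3) by (simp add: abs_minus_commute abs_le_iff)
  then have "\<eta> * \<tau> / (\<eta> + \<tau>) * \<bar>L w - L v\<bar> \<le> \<eta> * \<tau> / (\<eta> + \<tau>) * (d / \<eta>)"
    using assms by (intro mult_left_mono) auto
  moreover have "half_step C a \<tau> \<eta> v $ i - half_step C a \<tau> \<eta> w $ i
      = \<eta> * \<tau> / (\<eta> + \<tau>) * (L w - L v)"
    by (simp add: half_step_def L_def right_diff_distrib)
  moreover have "0 \<le> \<eta> * \<tau> / (\<eta> + \<tau>)" using assms by simp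
  ultimately show ?thesis using assms by (simp add: abs_mult)
qed

text \<open>Bounding the \<open>n\<close> exponentials from above costs ln n, from below K/\<eta> -
  ln n, which explains the maximum in \<open>R_const\<close>. The bracket is then at most R(\<eta> +
  \<tau>)/\<eta>, and the prefactor returns exactly \<open>\<tau> * R\<close>.\<close>

lemma half_step_abs_le:
  fixes C :: "real^'n^'m"
  assumes "0 < \<tau>" "0 < \<eta>" and v: "\<And>j. \<bar>v $ j\<bar> \<le> \<tau> * R"
    and C: "\<And>j. 0 \<le> C $ i $ j" "\<And>j. C $ i $ j \<le> K"
    and R: "\<bar>ln (a $ i)\<bar> + max (ln (real CARD('n))) (1 / \<eta> * K - ln (real CARD('n))) \<le> R"
  shows "\<bar>half_step C a \<tau> \<eta> v $ i\<bar> \<le> \<tau> * R"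
proof -
  define s where "s = (\<Sum>j\<in>UNIV. exp ((v $ j - C $ i $ j) / \<eta>))"
  define N where "N = real CARD('n)"
  have N: "0 < N" by (simp add: N_def)
  have s: "0 < s" unfolding s_def by (rule sum_exp_pos)
  have j: "- \<tau> * R - K \<le> v $ j - C $ i $ j" "v $ j - C $ i $ j \<le> \<tau> * R" for j
    using v[of j] C[of j] by auto
  have "s \<le> (\<Sum>j\<in>(UNIV :: 'n set). exp (\<tau> * R / \<eta>))"
    unfolding s_def using j(2) \<open>0 < \<eta>\<close> by (intro sum_mono) (simp add: divide_right_mono)
  then have "ln s \<le> ln (N * exp (\<tau> * R / \<eta>))" using s by (intro ln_mono) (auto simp: N_def)
  then have u: "ln s \<le> ln N + \<tau> * R / \<eta>" using N by (simp add: ln_mult)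
  have "(\<Sum>j\<in>(UNIV :: 'n set). exp ((- \<tau> * R - K) / \<eta>)) \<le> s"
    unfolding s_def using j(1) \<open>0 < \<eta>\<close>
    by (intro sum_mono) (simp add: divide_right_mono del: mult_minus_left)
  then have "ln (N * exp ((- \<tau> * R - K) / \<eta>)) \<le> ln s" using s N by (intro ln_mono) (auto simp: N_def)
  then have l: "ln N - \<tau> * R / \<eta> - 1 / \<eta> * K \<le> ln s"
    using N by (simp add: ln_mult diff_divide_distrib)
  have "\<bar>ln (a $ i) - ln s\<bar> \<le> R + \<tau> * R / \<eta>"
    using u l R unfolding N_def by (auto simp: abs_le_iff)
  then have "\<eta> * \<tau> / (\<eta> + \<tau>) * \<bar>ln (a $ i) - ln s\<bar> \<le> \<eta> * \<tau> / (\<eta> + \<tau>) * (R + \<tau> * R / \<eta>)"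
    using assms(1,2) by (intro mult_left_mono) auto
  also have "R + \<tau> * R / \<eta> = R * (\<eta> + \<tau>) / \<eta>"
    using assms(1,2) by (simp add: field_simps)
  also have "\<eta> * \<tau> / (\<eta> + \<tau>) * (R * (\<eta> + \<tau>) / \<eta>) = \<tau> * R"
    using assms(1,2) by (simp add: divide_simps)
  finally show ?thesis
    using assms(1,2) by (simp add: half_step_def s_def abs_mult)
qed

lemma continuous_on_half_step:
  assumes "\<eta> \<noteq> 0"
  shows "continuous_on S (half_step C a \<tau> \<eta>)"
proof -
  have "continuous_on S (\<lambda>v. half_step C a \<tau> \<eta> v)"
    unfolding half_step_def
    by (intro continuous_on_vec_lambda continuous_intros)
       (use assms in \<open>auto simp: less_imp_neq[OF sum_exp_pos, symmetric]\<close>)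
  then show ?thesis .
qed

lemma max_norm_ge: "\<bar>C $ i $ j\<bar> \<le> max_norm C"
proof -
  have "{\<bar>C $ i $ j\<bar> |i j. True} = (\<lambda>(i, j). \<bar>C $ i $ j\<bar>) ` UNIV" by auto
  then have "finite {\<bar>C $ i $ j\<bar> |i j. True}" by simp
  then show ?thesis unfolding max_norm_def by (intro Max_ge) auto
qed

text \<open>A half step solves the first-order condition u + \<tau> ln(row sum / a) = 0 exactly; the
  prefactor comes from solving this linear equation for u.\<close>

lemma half_step_eq_imp_ln_row_sums:
  assumes "0 < \<tau>" "0 < \<eta>" "0 < a $ i" "u = half_step C a \<tau> \<eta> v"
  shows "\<tau> * ln (exp (u $ i / \<eta>) * (\<Sum>j\<in>UNIV. exp ((v $ j - C $ i $ j) / \<eta>)) / a $ i) = - u $ i"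
proof -
  define s where "s = (\<Sum>j\<in>UNIV. exp ((v $ j - C $ i $ j) / \<eta>))"
  have s: "0 < s" unfolding s_def by (rule sum_exp_pos)
  have "u $ i = \<eta> * \<tau> / (\<eta> + \<tau>) * (ln (a $ i) - ln s)"
    unfolding assms(4) by (simp add: half_step_def s_def)
  moreover have "\<tau> * (\<eta> * \<tau> / (\<eta> + \<tau>) * D / \<eta> - D) = - (\<eta> * \<tau> / (\<eta> + \<tau>) * D)" for D
  proof -
    have "\<eta> + \<tau> \<noteq> 0" "\<eta> \<noteq> 0" using assms by auto
    then show ?thesis by (simp add: divide_simps) (simp add: algebra_simps)
  qed
  ultimately have "\<tau> * (u $ i / \<eta> - (ln (a $ i) - ln s)) = - u $ i" by simp
  then show ?thesis
    using s assms(3) unfolding s_def[symmetric] by (simp add: ln_mult ln_div algebra_simps)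
qed

section \<open>Existence of a fixed point in the cube\<close>

context unbalanced_ot
begin

text \<open>Eliminating \<open>u\<close> leaves a continuous self-map of a cube for \<open>v\<close>
  alone, to which Brouwer's theorem applies; \<open>u\<close> is recovered as the half step of
  \<open>v\<close> and so lies in the same cube.\<close>

lemma half_step_fixpoint_exists:
  assumes "0 < \<eta>"
  obtains u v where "u = half_step C a \<tau> \<eta> v" "v = half_step (transpose C) b \<tau> \<eta> u"
    "\<And>i. \<bar>u $ i\<bar> \<le> \<tau> * R_const C a b \<eta>" "\<And>j. \<bar>v $ j\<bar> \<le> \<tau> * R_const C a b \<eta>"
proof -
  define R where "R = R_const C a b \<eta>"
  define Q where "Q = {v :: real^'n. \<forall>i. \<bar>v $ i\<bar> \<le> \<tau> * R}"
  have a: "\<bar>half_step C a \<tau> \<eta> v $ i\<bar> \<le> \<tau> * R" if "v \<in> Q" for v i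
  proof (rule half_step_abs_le[OF \<tau>_pos assms])
    show "\<bar>ln (a $ i)\<bar> + max (ln (real CARD('n))) (1 / \<eta> * max_norm C - ln (real CARD('n))) \<le> R"
      using component_le_infnorm_cart[of "vlog a" i] unfolding R_def R_const_def vlog_def by simp
  qed (use that C_nonneg max_norm_ge[of C i] in \<open>auto simp: Q_def abs_le_iff\<close>)
  have b: "\<bar>half_step (transpose C) b \<tau> \<eta> u $ i\<bar> \<le> \<tau> * R" if "u \<in> Q" for u i
  proof (rule half_step_abs_le[OF \<tau>_pos assms])
    show "\<bar>ln (b $ i)\<bar> + max (ln (real CARD('n))) (1 / \<eta> * max_norm C - ln (real CARD('n))) \<le> R"
      using component_le_infnorm_cart[of "vlog b" i] unfolding R_def R_const_def vlog_def by simp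
  qed (use that C_nonneg max_norm_ge[of C _ i] in \<open>auto simp: Q_def abs_le_iff transpose_def\<close>)
  have "0 \<le> ln (real CARD('n))" by (simp add: Suc_leI)
  then have "0 \<le> R"
    using infnorm_pos_le[of "vlog a"] unfolding R_def R_const_def by linarith
  then have "0 \<in> Q" using \<tau>_pos by (simp add: Q_def)
  have Q: "Q = cbox (\<chi> i. - (\<tau> * R)) (\<chi> i. \<tau> * R)"
    by (auto simp: Q_def mem_box_cart abs_le_iff) (smt (verit))+
  let ?f = "\<lambda>v. half_step (transpose C) b \<tau> \<eta> (half_step C a \<tau> \<eta> v)"
  obtain v where v: "v \<in> Q" "?f v = v"
  proof (rule brouwer[of Q ?f])
    show "compact Q" "convex Q" unfolding Q by auto
    show "Q \<noteq> {}" using \<open>0 \<in> Q\<close> by auto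
    show "continuous_on Q ?f"
      using assms
      by (intro continuous_on_compose2[OF continuous_on_half_step[where S = UNIV] continuous_on_half_step])
         auto
    show "?f \<in> Q \<rightarrow> Q" using a b unfolding Q_def by auto
  qed
  show ?thesis
    by (rule that[of "half_step C a \<tau> \<eta> v" v]) (use v a in \<open>auto simp: Q_def R_def\<close>)
qed

end

section \<open>Plans of exponential form\<close>

lemma nonneg_mat_sinkhorn_plan: "nonneg_mat (sinkhorn_plan C \<eta> u v)"
  by (simp add: nonneg_mat_def sinkhorn_plan_def)

lemma mass_sinkhorn_plan_pos: "0 < mass (sinkhorn_plan C \<eta> u v)"
  unfolding mass_def sinkhorn_plan_def by (simp add: sum_exp_pos sum_pos)

lemma sums_sinkhorn_plan_pos:
  "0 < row_sums (sinkhorn_plan C \<eta> u v) $ i" "0 < col_sums (sinkhorn_plan C \<eta> u v) $ j"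
  by (simp_all add: row_sums_def col_sums_def sinkhorn_plan_def sum_exp_pos)

lemma sinkhorn_plan_le:
  assumes "0 < \<eta>" "\<And>i. \<bar>u $ i - u' $ i\<bar> \<le> d" "\<And>j. \<bar>v $ j - v' $ j\<bar> \<le> d"
  shows "sinkhorn_plan C \<eta> u v $ i $ j \<le> exp (2 * d / \<eta>) * sinkhorn_plan C \<eta> u' v' $ i $ j"
proof -
  have "u $ i + v $ j - C $ i $ j \<le> 2 * d + (u' $ i + v' $ j - C $ i $ j)"
    using assms(2)[of i] assms(3)[of j] by linarith
  then have "(u $ i + v $ j - C $ i $ j) / \<eta> \<le> 2 * d / \<eta> + (u' $ i + v' $ j - C $ i $ j) / \<eta>"
    unfolding add_divide_distrib[symmetric] using \<open>0 < \<eta>\<close> by (simp add: divide_right_mono)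
  then show ?thesis by (simp add: sinkhorn_plan_def exp_add[symmetric])
qed

context unbalanced_ot
begin

text \<open>Since \<eta> ln B = u + v - C entrywise, the transport cost cancels against the entropy.
  The remaining brackets are the first-order residuals, which vanish at a fixed point.\<close>

lemma regularized_objective_sinkhorn_plan:
  fixes \<eta> :: real and u v :: "real^'n"
  assumes "0 < \<eta>"
  defines "B \<equiv> sinkhorn_plan C \<eta> u v"
  shows "uot_objective C a b \<tau> B + \<eta> * neg_entropy B =
    (\<Sum>i\<in>UNIV. row_sums B $ i * (u $ i + \<tau> * ln (row_sums B $ i / a $ i)))
    + (\<Sum>j\<in>UNIV. col_sums B $ j * (v $ j + \<tau> * ln (col_sums B $ j / b $ j)))
    - (2 * \<tau> + \<eta>) * mass B + \<tau> * (sum (($) a) UNIV + sum (($) b) UNIV)"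
proof -
  have "\<eta> * (B $ i $ j * ln (B $ i $ j) - B $ i $ j)
      = B $ i $ j * u $ i + B $ i $ j * v $ j - C $ i $ j * B $ i $ j - \<eta> * B $ i $ j" for i j
    using assms(1) by (simp add: B_def sinkhorn_plan_def field_simps)
  then have "\<eta> * neg_entropy B = (\<Sum>i\<in>UNIV. \<Sum>j\<in>UNIV.
      B $ i $ j * u $ i + B $ i $ j * v $ j - C $ i $ j * B $ i $ j - \<eta> * B $ i $ j)"
    by (simp add: neg_entropy_def sum_distrib_left)
  also have "\<dots> = (\<Sum>i\<in>UNIV. row_sums B $ i * u $ i) + (\<Sum>j\<in>UNIV. col_sums B $ j * v $ j)
      - C \<bullet> B - \<eta> * mass B"
    by (simp add: sum.distrib sum_subtractf sum_mult_row_sums sum_mult_col_sums inner_vec_def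
        mass_def sum_distrib_left)
  finally have ent: "\<eta> * neg_entropy B = \<dots>" .
  have a: "\<tau> * KL (row_sums B) a = (\<Sum>i\<in>UNIV. row_sums B $ i * (\<tau> * ln (row_sums B $ i / a $ i)))
      - \<tau> * mass B + \<tau> * sum (($) a) UNIV"
    by (simp add: KL_def sum.distrib sum_subtractf mass_row_sums sum_distrib_left algebra_simps)
  have b: "\<tau> * KL (col_sums B) b = (\<Sum>j\<in>UNIV. col_sums B $ j * (\<tau> * ln (col_sums B $ j / b $ j)))
      - \<tau> * mass B + \<tau> * sum (($) b) UNIV"
    by (simp add: KL_def sum.distrib sum_subtractf mass_col_sums sum_distrib_left algebra_simps)
  show ?thesis
    unfolding uot_objective_eq ent a b distrib_left sum.distrib by (simp add: algebra_simps)
qed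

end

section \<open>Optimality and mass of the fixed-point plan\<close>

locale sinkhorn_fixpoint = unbalanced_ot C a b \<tau> for C :: "real^'n^'n" and a b \<tau> +
  fixes \<eta> :: real and us vs :: "real^'n"
  assumes \<eta>_pos: "0 < \<eta>"
    and us_eq: "us = half_step C a \<tau> \<eta> vs"
    and vs_eq: "vs = half_step (transpose C) b \<tau> \<eta> us"
begin

abbreviation Xs :: "real^'n^'n" where "Xs \<equiv> sinkhorn_plan C \<eta> us vs"

abbreviation total :: real where "total \<equiv> sum (($) a) UNIV + sum (($) b) UNIV"

lemma fixpoint_ln_row_sums: "\<tau> * ln (row_sums Xs $ i / a $ i) = - us $ i"
  unfolding row_sums_sinkhorn_plan
  by (rule half_step_eq_imp_ln_row_sums[OF \<tau>_pos \<eta>_pos a_pos us_eq])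

lemma fixpoint_ln_col_sums: "\<tau> * ln (col_sums Xs $ j / b $ j) = - vs $ j"
  unfolding col_sums_sinkhorn_plan
  by (rule half_step_eq_imp_ln_row_sums[OF \<tau>_pos \<eta>_pos b_pos vs_eq])

lemma regularized_objective_fixpoint:
  "uot_objective C a b \<tau> Xs + \<eta> * neg_entropy Xs = \<tau> * total - (2 * \<tau> + \<eta>) * mass Xs"
  by (simp add: regularized_objective_sinkhorn_plan[OF \<eta>_pos] fixpoint_ln_row_sums
      fixpoint_ln_col_sums)

text \<open>After the tangent bounds at \<open>Xs\<close>, all terms linear in \<open>X\<close>
  cancel: the marginal tangents have slopes \<open>- us\<close> and \<open>- vs\<close>, the entropy
  tangent has slope us + vs - C, and the cost contributes C. Only the constants survive.\<close>

lemma regularized_objective_ge: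
  assumes X: "nonneg_mat X"
  shows "\<tau> * total - (2 * \<tau> + \<eta>) * mass Xs \<le> uot_objective C a b \<tau> X + \<eta> * neg_entropy X"
proof -
  have "(\<Sum>i\<in>UNIV. row_sums X $ i * ln (row_sums Xs $ i / a $ i) - row_sums Xs $ i + a $ i)
      \<le> KL (row_sums X) a" (is "?l \<le> _")
    by (intro KL_ge_tangent sums_nonneg X a_pos sums_sinkhorn_plan_pos)
  then have "\<tau> * ?l \<le> \<tau> * KL (row_sums X) a" using \<tau>_pos by simp
  also have "\<tau> * ?l = (\<Sum>i\<in>UNIV. row_sums X $ i * (\<tau> * ln (row_sums Xs $ i / a $ i)))
      - \<tau> * mass Xs + \<tau> * sum (($) a) UNIV"
    by (simp add: sum.distrib sum_subtractf mass_row_sums sum_distrib_left algebra_simps)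
  finally have a: "- (\<Sum>i\<in>UNIV. row_sums X $ i * us $ i) - \<tau> * mass Xs + \<tau> * sum (($) a) UNIV
      \<le> \<tau> * KL (row_sums X) a"
    unfolding fixpoint_ln_row_sums by (simp add: sum_negf)
  have "(\<Sum>j\<in>UNIV. col_sums X $ j * ln (col_sums Xs $ j / b $ j) - col_sums Xs $ j + b $ j)
      \<le> KL (col_sums X) b" (is "?m \<le> _")
    by (intro KL_ge_tangent sums_nonneg X b_pos sums_sinkhorn_plan_pos)
  then have "\<tau> * ?m \<le> \<tau> * KL (col_sums X) b" using \<tau>_pos by simp
  also have "\<tau> * ?m = (\<Sum>j\<in>UNIV. col_sums X $ j * (\<tau> * ln (col_sums Xs $ j / b $ j)))
      - \<tau> * mass Xs + \<tau> * sum (($) b) UNIV"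
    by (simp add: sum.distrib sum_subtractf mass_col_sums sum_distrib_left algebra_simps)
  finally have b: "- (\<Sum>j\<in>UNIV. col_sums X $ j * vs $ j) - \<tau> * mass Xs + \<tau> * sum (($) b) UNIV
      \<le> \<tau> * KL (col_sums X) b"
    unfolding fixpoint_ln_col_sums by (simp add: sum_negf)
  have "X $ i $ j * us $ i + X $ i $ j * vs $ j - C $ i $ j * X $ i $ j - \<eta> * Xs $ i $ j
      \<le> \<eta> * (X $ i $ j * ln (X $ i $ j) - X $ i $ j)" for i j
  proof -
    have "\<eta> * (X $ i $ j * ln (Xs $ i $ j) - Xs $ i $ j) \<le> \<eta> * (X $ i $ j * ln (X $ i $ j) - X $ i $ j)"
      using X \<eta>_pos
      by (intro mult_left_mono gibbs_pointwise) (auto simp: nonneg_mat_def sinkhorn_plan_def)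
    moreover have "\<eta> * (X $ i $ j * ln (Xs $ i $ j) - Xs $ i $ j)
      = X $ i $ j * us $ i + X $ i $ j * vs $ j - C $ i $ j * X $ i $ j - \<eta> * Xs $ i $ j"
      using \<eta>_pos by (simp add: sinkhorn_plan_def field_simps)
    ultimately show ?thesis by simp
  qed
  then have "(\<Sum>i\<in>UNIV. \<Sum>j\<in>UNIV. X $ i $ j * us $ i + X $ i $ j * vs $ j - C $ i $ j * X $ i $ j
      - \<eta> * Xs $ i $ j) \<le> \<eta> * neg_entropy X"
    unfolding neg_entropy_def sum_distrib_left by (intro sum_mono)
  moreover have "(\<Sum>i\<in>UNIV. \<Sum>j\<in>UNIV. X $ i $ j * us $ i + X $ i $ j * vs $ j - C $ i $ j * X $ i $ j
      - \<eta> * Xs $ i $ j) = (\<Sum>i\<in>UNIV. row_sums X $ i * us $ i)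
      + (\<Sum>j\<in>UNIV. col_sums X $ j * vs $ j) - C \<bullet> X - \<eta> * mass Xs"
    by (simp add: sum.distrib sum_subtractf sum_mult_row_sums sum_mult_col_sums inner_vec_def
        mass_def sum_distrib_left)
  ultimately show ?thesis
    using a b unfolding uot_objective_eq by (simp add: algebra_simps)
qed

text \<open>The exact value of the regularized objective decreases in the mass, while nonnegativity
  of the objective and the entropy bound limit it from below. Small \<eta> keeps the resulting
  coefficient of the mass at least 3\<tau>/2.\<close>

lemma mass_fixpoint_le:
  defines "L \<equiv> ln (real CARD('n))"
  assumes "2 \<le> CARD('n)" "\<eta> * L \<le> \<tau> / 4" "\<eta> * total * L \<le> \<tau> / 4"
  shows "mass Xs \<le> total / 2 + 1 / 6 + 1 / (6 * L)"
proof -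
  let ?x = "mass Xs"
  have L: "0 < L" using assms(2) by (simp add: L_def)
  have "?x * ln ?x - ?x - 2 * ?x * L \<le> neg_entropy Xs"
    unfolding L_def by (intro neg_entropy_ge nonneg_mat_sinkhorn_plan mass_sinkhorn_plan_pos)
  then have "- 1 - 2 * ?x * L \<le> neg_entropy Xs"
    using xlnx_minus_x_ge[of ?x] mass_sinkhorn_plan_pos[of C \<eta> us vs] by simp
  then have "\<eta> * (- 1 - 2 * ?x * L) \<le> \<eta> * neg_entropy Xs" using \<eta>_pos by simp
  moreover have "0 \<le> uot_objective C a b \<tau> Xs"
    by (intro uot_objective_nonneg nonneg_mat_sinkhorn_plan)
  moreover have "0 \<le> \<eta> * ?x" using \<eta>_pos mass_sinkhorn_plan_pos[of C \<eta> us vs] by simp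
  ultimately have "2 * \<tau> * ?x - 2 * (\<eta> * L) * ?x \<le> \<tau> * total + \<eta>"
    using regularized_objective_fixpoint by (simp add: algebra_simps)
  moreover have "(2 * \<tau> - 2 * (\<eta> * L)) * (?x - total / 2)
      = 2 * \<tau> * ?x - 2 * (\<eta> * L) * ?x - \<tau> * total + \<eta> * total * L"
    by (simp add: field_simps)
  ultimately have "(2 * \<tau> - 2 * (\<eta> * L)) * (?x - total / 2) \<le> \<eta> + \<eta> * total * L"
    by linarith
  moreover have "\<eta> \<le> \<tau> / (4 * L)" using assms(3) L by (simp add: field_simps)
  ultimately have *: "(2 * \<tau> - 2 * (\<eta> * L)) * (?x - total / 2) \<le> \<tau> / (4 * L) + \<tau> / 4"
    using assms(4) by linarith
  have "?x - total / 2 \<le> 1 / (6 * L) + 1 / 6"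
  proof (rule ccontr)
    assume "\<not> ?thesis"
    then have h: "1 / (6 * L) + 1 / 6 < ?x - total / 2" by simp
    \<comment> \<open>The constants are \<tau>/(4L) and \<tau>/4 divided by 3\<tau>/2. Arguing by
      contradiction supplies the sign of \<open>?x - total / 2\<close> needed to enlarge the
      coefficient.\<close>
    have "3 * \<tau> / 2 * (1 / (6 * L) + 1 / 6) < 3 * \<tau> / 2 * (?x - total / 2)"
      using h \<tau>_pos by (intro mult_strict_left_mono) auto
    also have "\<dots> \<le> (2 * \<tau> - 2 * (\<eta> * L)) * (?x - total / 2)"
    proof (rule mult_right_mono)
      have "0 < 1 / (6 * L)" using L by simp
      then show "0 \<le> ?x - total / 2" using h by linarith
    qed (use assms(3) in simp)
    finally show False using * L by (simp add: field_simps)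
  qed
  then show ?thesis by simp
qed

section \<open>Stability under perturbation of the potentials\<close>

text \<open>Errors of at most \<open>d\<close> in both potentials change each entry, and hence each
  marginal and the mass, by a factor within exp(t) either way. Each first-order residual is then at
  most \<open>d + \<tau> * t\<close>, and trading the mass of \<open>Xs\<close> for that of
  \<open>B\<close> costs the exp(t) - 1 term.\<close>

lemma perturbed_plan:
  fixes u v :: "real^'n" and d :: real
  defines "B \<equiv> sinkhorn_plan C \<eta> u v" and "t \<equiv> 2 * d / \<eta>"
  assumes u: "\<And>i. \<bar>u $ i - us $ i\<bar> \<le> d" and v: "\<And>j. \<bar>v $ j - vs $ j\<bar> \<le> d"
  shows "mass B \<le> exp t * mass Xs"
    and "uot_objective C a b \<tau> B + \<eta> * neg_entropy B
      \<le> \<tau> * total - (2 * \<tau> + \<eta>) * mass Xs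
        + mass B * (2 * (d + \<tau> * t) + (2 * \<tau> + \<eta>) * (exp t - 1))"
proof -
  have le: "B $ i $ j \<le> exp t * Xs $ i $ j" for i j
    unfolding B_def t_def by (intro sinkhorn_plan_le \<eta>_pos u v)
  have ge: "Xs $ i $ j \<le> exp t * B $ i $ j" for i j
    unfolding B_def t_def using u v
    by (intro sinkhorn_plan_le \<eta>_pos) (simp_all add: abs_minus_commute)
  show "mass B \<le> exp t * mass Xs"
    unfolding mass_def sum_distrib_left by (intro sum_mono le)
  have mass: "mass Xs \<le> exp t * mass B"
    unfolding mass_def sum_distrib_left by (intro sum_mono ge)
  have pos: "0 < row_sums B $ i" "0 < col_sums B $ i" for i
    unfolding B_def by (rule sums_sinkhorn_plan_pos)+
  have r: "u $ i + \<tau> * ln (row_sums B $ i / a $ i) \<le> d + \<tau> * t" for i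
  proof -
    have "row_sums B $ i \<le> exp t * row_sums Xs $ i"
      unfolding row_sums_def by (simp add: sum_distrib_left) (intro sum_mono le)
    then have "ln (row_sums B $ i / a $ i) \<le> ln (exp t * (row_sums Xs $ i / a $ i))"
      using pos(1)[of i] a_pos[of i] by (intro ln_mono) (auto intro: divide_right_mono)
    also have "\<dots> = t + ln (row_sums Xs $ i / a $ i)"
      using sums_sinkhorn_plan_pos(1)[of C \<eta> us vs i] a_pos[of i] by (subst ln_mult_pos) auto
    finally have "\<tau> * ln (row_sums B $ i / a $ i) \<le> \<tau> * (t + ln (row_sums Xs $ i / a $ i))"
      using \<tau>_pos by simp
    then show ?thesis
      using fixpoint_ln_row_sums[of i] u[of i] by (simp add: distrib_left)
  qed
  have c: "v $ j + \<tau> * ln (col_sums B $ j / b $ j) \<le> d + \<tau> * t" for j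
  proof -
    have "col_sums B $ j \<le> exp t * col_sums Xs $ j"
      unfolding col_sums_def by (simp add: sum_distrib_left) (intro sum_mono le)
    then have "ln (col_sums B $ j / b $ j) \<le> ln (exp t * (col_sums Xs $ j / b $ j))"
      using pos(2)[of j] b_pos[of j] by (intro ln_mono) (auto intro: divide_right_mono)
    also have "\<dots> = t + ln (col_sums Xs $ j / b $ j)"
      using sums_sinkhorn_plan_pos(2)[of C \<eta> us vs j] b_pos[of j] by (subst ln_mult_pos) auto
    finally have "\<tau> * ln (col_sums B $ j / b $ j) \<le> \<tau> * (t + ln (col_sums Xs $ j / b $ j))"
      using \<tau>_pos by simp
    then show ?thesis
      using fixpoint_ln_col_sums[of j] v[of j] by (simp add: distrib_left)
  qed
  have "(\<Sum>i\<in>UNIV. row_sums B $ i * (u $ i + \<tau> * ln (row_sums B $ i / a $ i)))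
      \<le> (\<Sum>i\<in>UNIV. row_sums B $ i * (d + \<tau> * t))"
    using pos by (intro sum_mono mult_left_mono r) (simp add: less_imp_le)
  moreover have "(\<Sum>j\<in>UNIV. col_sums B $ j * (v $ j + \<tau> * ln (col_sums B $ j / b $ j)))
      \<le> (\<Sum>j\<in>UNIV. col_sums B $ j * (d + \<tau> * t))"
    using pos by (intro sum_mono mult_left_mono c) (simp add: less_imp_le)
  moreover have "(\<Sum>i\<in>UNIV. row_sums B $ i * (d + \<tau> * t)) = mass B * (d + \<tau> * t)"
    "(\<Sum>j\<in>UNIV. col_sums B $ j * (d + \<tau> * t)) = mass B * (d + \<tau> * t)"
    by (simp only: mass_row_sums sum_distrib_right, simp only: mass_col_sums sum_distrib_right)
  moreover have "(2 * \<tau> + \<eta>) * mass Xs \<le> (2 * \<tau> + \<eta>) * (exp t * mass B)"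
    using mass \<tau>_pos \<eta>_pos by (intro mult_left_mono) auto
  ultimately show "uot_objective C a b \<tau> B + \<eta> * neg_entropy B
      \<le> \<tau> * total - (2 * \<tau> + \<eta>) * mass Xs
        + mass B * (2 * (d + \<tau> * t) + (2 * \<tau> + \<eta>) * (exp t - 1))"
    unfolding B_def regularized_objective_sinkhorn_plan[OF \<eta>_pos] by (simp add: algebra_simps)
qed

lemma objective_le_of_close_potentials:
  defines "L \<equiv> ln (real CARD('n))"
  assumes n: "2 \<le> CARD('n)" and \<eta>_half: "\<eta> \<le> 1 / 2"
    and \<eta>L: "\<eta> * L \<le> \<tau> / 4" "\<eta> * total * L \<le> \<tau> / 4"
    and u: "\<And>i. \<bar>u $ i - us $ i\<bar> \<le> d" and v: "\<And>j. \<bar>v $ j - vs $ j\<bar> \<le> d"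
    and d: "d \<le> \<eta>\<^sup>2 / (8 * (\<tau> + 1))"
    and min: "is_arg_min (uot_objective C a b \<tau>) nonneg_mat Xhat"
  shows "uot_objective C a b \<tau> (sinkhorn_plan C \<eta> u v) \<le> uot_objective C a b \<tau> Xhat
    + \<eta> * (S_const CARD('n) (sum (($) a) UNIV) (sum (($) b) UNIV)
          + T_const CARD('n) (sum (($) a) UNIV) (sum (($) b) UNIV))"
proof -
  define B where "B = sinkhorn_plan C \<eta> u v"
  define t where "t = 2 * d / \<eta>"
  define A where "A = total / 2"
  define S where "S = S_const CARD('n) (sum (($) a) UNIV) (sum (($) b) UNIV)"
  have S: "S = A + 1 / 2 + 1 / (4 * L)" by (simp add: S_def S_const_def A_def L_def)
  have L: "0 < L" using n by (simp add: L_def)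
  have A: "0 < A"
    unfolding A_def using a_pos b_pos by (simp add: sum_pos add_pos_pos)
  have "0 \<le> d" using u[of undefined] by linarith
  then have t0: "0 \<le> t" using \<eta>_pos by (simp add: t_def)
  have t\<eta>: "t * (4 * (\<tau> + 1)) \<le> \<eta>"
  proof -
    have "2 * d / \<eta> * (4 * (\<tau> + 1)) = d * (8 * (\<tau> + 1)) / \<eta>" by simp
    also have "d * (8 * (\<tau> + 1)) \<le> \<eta>\<^sup>2"
      using d \<tau>_pos by (simp add: pos_le_divide_eq)
    then have "d * (8 * (\<tau> + 1)) / \<eta> \<le> \<eta>\<^sup>2 / \<eta>" using \<eta>_pos by (intro divide_right_mono) auto
    finally show ?thesis using \<eta>_pos by (simp add: t_def power2_eq_square)
  qed
  have t\<tau>: "0 \<le> t * \<tau>" using t0 \<tau>_pos by simp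
  \<comment> \<open>Both terms of 4t + 4t\<tau> are nonnegative and their sum is at most
    1/2.\<close>
  have t8: "t \<le> 1 / 8" using t\<eta> \<eta>_half t\<tau> by (simp add: algebra_simps)
  have et: "exp t - 1 \<le> t + t\<^sup>2" using exp_bound[of t] t0 t8 by simp

  have x: "0 < mass B" unfolding B_def by (rule mass_sinkhorn_plan_pos)
  have xs: "mass Xs \<le> A + 1 / 6 + 1 / (6 * L)"
    unfolding A_def L_def by (rule mass_fixpoint_le) (use n \<eta>L in \<open>auto simp: L_def\<close>)
  have xS: "mass B \<le> S"
  proof -
    have "t * t \<le> 1 / 8 * t" using t0 t8 by (intro mult_right_mono) auto
    then have "exp t \<le> 1 + 9 / 8 * t" using et by (simp add: power2_eq_square)
    then have "exp t * mass Xs \<le> (1 + 9 / 8 * t) * (A + 1 / 6 + 1 / (6 * L))"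
      using xs t0 mass_sinkhorn_plan_pos[of C \<eta> us vs] by (intro mult_mono) auto
    also have "\<dots> = A + 1 / 6 + 1 / (6 * L) + 9 / 8 * (t * A) + 9 / 8 * t * (1 / 6 + 1 / (6 * L))"
      by (simp add: algebra_simps)
    \<comment> \<open>The mass \<open>A\<close> may be large, so t \<le> 1/8 would not do; the
      smallness of \<eta> relative to \<tau>/(A L) makes the relative error an absolute one.\<close>
    also have "t * A \<le> 1 / (32 * L)"
    proof -
      have "t * (4 * (\<tau> + 1)) * (A * L) \<le> \<eta> * (A * L)"
        using t\<eta> A L by (intro mult_right_mono) auto
      also have "\<dots> \<le> (\<tau> + 1) / 8" using \<eta>L(2) \<tau>_pos by (simp add: A_def algebra_simps)
      finally have "(\<tau> + 1) * (t * A * L * 32) \<le> (\<tau> + 1) * 1" by (simp add: algebra_simps)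
      then have "t * A * L * 32 \<le> 1" using \<tau>_pos by (simp only: mult_le_cancel_left_pos)
      then show ?thesis using L by (simp add: field_simps)
    qed
    also have "9 / 8 * t * (1 / 6 + 1 / (6 * L)) \<le> 9 / 8 * (1 / 8) * (1 / 6 + 1 / (6 * L))"
      using t8 L by (intro mult_right_mono mult_left_mono) auto
    finally have "mass B \<le> A + 1 / 6 + 1 / (6 * L) + 9 / 8 * (1 / (32 * L))
        + 9 / 8 * (1 / 8) * (1 / 6 + 1 / (6 * L))"
      using perturbed_plan(1)[OF u v] by (simp add: B_def t_def)
    \<comment> \<open>The constants add up to less than 1/2, and the coefficients of 1/L to about
      0.225, below the 1/4 in \<open>S\<close>.\<close>
    also have "\<dots> \<le> S"
      using L unfolding S by (simp add: divide_simps) (simp add: algebra_simps)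
    finally show ?thesis .
  qed
  \<comment> \<open>The perturbation error per unit of mass is at most \<eta>: it is bounded by
    t(2\<tau> + \<eta>)(2 + t), and the last two factors together stay below 4(\<tau> + 1).\<close>
  have "2 * (d + \<tau> * t) + (2 * \<tau> + \<eta>) * (exp t - 1) \<le> \<eta>"
  proof -
    have "(2 * \<tau> + \<eta>) * (exp t - 1) \<le> (2 * \<tau> + \<eta>) * (t + t\<^sup>2)"
      using et \<tau>_pos \<eta>_pos by (intro mult_left_mono) auto
    moreover have "2 * d = t * \<eta>" using \<eta>_pos by (simp add: t_def)
    ultimately have "2 * (d + \<tau> * t) + (2 * \<tau> + \<eta>) * (exp t - 1) \<le> t * ((2 * \<tau> + \<eta>) * (2 + t))"
      by (simp add: algebra_simps power2_eq_square)
    also have "(2 * \<tau> + \<eta>) * (2 + t) \<le> (2 * \<tau> + 1 / 2) * (2 + t)"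
      using \<eta>_half t0 by (intro mult_right_mono) auto
    also have "\<dots> \<le> 4 * (\<tau> + 1)"
    proof -
      define p where "p = t * \<tau>"
      have "4 * t + 4 * p \<le> \<eta>" using t\<eta> by (simp add: p_def algebra_simps)
      then have "2 * p + t / 2 \<le> 3" using t8 t0 \<eta>_half by linarith
      then show ?thesis by (simp add: p_def field_simps)
    qed
    finally show ?thesis using t0 t\<eta> by (simp add: mult_left_mono)
  qed
  then have "mass B * (2 * (d + \<tau> * t) + (2 * \<tau> + \<eta>) * (exp t - 1)) \<le> mass B * \<eta>"
    using x by (intro mult_left_mono) auto
  also have "\<dots> \<le> \<eta> * S" using xS \<eta>_pos by simp
  finally have gB: "uot_objective C a b \<tau> B + \<eta> * neg_entropy B
      \<le> \<tau> * total - (2 * \<tau> + \<eta>) * mass Xs + \<eta> * S"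
    using perturbed_plan(2)[OF u v] unfolding B_def t_def by linarith

  have Xhat: "nonneg_mat Xhat" using min by (simp add: is_arg_min_def)
  have "neg_entropy Xhat \<le> mass Xhat * ln (mass Xhat) - mass Xhat"
    by (rule neg_entropy_le[OF Xhat])
  also have "\<dots> \<le> A * ln A - A + 1"
    using mass_nonneg[OF Xhat] mass_minimizer_le[OF min]
    unfolding A_def by (intro xlnx_minus_x_le_of_le) auto
  finally have hhat: "neg_entropy Xhat \<le> A * ln A - A + 1" .
  have "- 1 - 2 * (mass B * L) \<le> neg_entropy B"
    using neg_entropy_ge[OF nonneg_mat_sinkhorn_plan mass_sinkhorn_plan_pos, of C \<eta> u v]
      xlnx_minus_x_ge[of "mass B"] x unfolding B_def L_def by simp
  moreover have "mass B * L \<le> S * L" using xS L by simp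
  ultimately have "neg_entropy Xhat - neg_entropy B \<le> A * ln A - A + 1 + 1 + 2 * (S * L)"
    using hhat by argo
  \<comment> \<open>The term 1/(4L) of \<open>S\<close> becomes constant here; doubled, it supplies
    the final 1/2 of 5/2 = 1 + 1 + 1/2 in \<open>T_const\<close>.\<close>
  also have "S * L = A * L + L / 2 + 1 / 4" using L by (simp add: S field_simps)
  also have "A * ln A - A + 1 + 1 + 2 * (A * L + L / 2 + 1 / 4)
      = T_const CARD('n) (sum (($) a) UNIV) (sum (($) b) UNIV)" (is "_ = ?T")
    by (simp add: T_const_def L_def[symmetric] A_def[symmetric] algebra_simps)
  finally have "\<eta> * (neg_entropy Xhat - neg_entropy B) \<le> \<eta> * ?T"
    using \<eta>_pos by (intro mult_left_mono) auto
  then show ?thesis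
    using gB regularized_objective_ge[OF Xhat]
    unfolding B_def[symmetric] S_def[symmetric] by (simp add: algebra_simps)
qed

section \<open>Linear convergence of the potentials\<close>

text \<open>The potential just updated has error at most q times that of the other one, which was
  updated one step earlier, so the two exponents alternate in taking the lead. The first step
  overwrites \<open>u\<close> using v = 0, so the induction starts from a bound on \<open>vs\<close>
  alone.\<close>

lemma sinkhorn_Suc_dist_le:
  fixes D :: real
  defines "q \<equiv> \<tau> / (\<eta> + \<tau>)"
  assumes D: "\<And>j. \<bar>vs $ j\<bar> \<le> D"
  assumes "sinkhorn C a b \<tau> \<eta> (Suc k) = (u, v)"
  shows "\<bar>u $ i - us $ i\<bar> \<le> q ^ (if even k then Suc k else k) * D
    \<and> \<bar>v $ j - vs $ j\<bar> \<le> q ^ (if even k then k else Suc k) * D"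
  using assms(3)
proof (induction k arbitrary: u v i j)
  case 0
  then have "u = half_step C a \<tau> \<eta> 0" "v = 0"
    by (auto simp: sinkhorn_Suc_half_step[of C a b \<tau> \<eta> 0 0 0] simp del: sinkhorn.simps(2))
  moreover have "\<bar>half_step C a \<tau> \<eta> 0 $ i - us $ i\<bar> \<le> q * D"
    unfolding q_def by (subst us_eq, rule half_step_lipschitz) (use \<tau>_pos \<eta>_pos D in auto)
  ultimately show ?case using D by simp
next
  case (Suc k)
  obtain u' v' where s: "sinkhorn C a b \<tau> \<eta> (Suc k) = (u', v')" by fastforce
  note IH = Suc.IH[OF s]
  show ?case
  proof (cases "even k")
    case True
    then have uv: "u = u'" "v = half_step (transpose C) b \<tau> \<eta> u'"
      using Suc.prems sinkhorn_Suc_half_step[OF s] by (auto simp del: sinkhorn.simps)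
    have "\<bar>half_step (transpose C) b \<tau> \<eta> u' $ j - half_step (transpose C) b \<tau> \<eta> us $ j\<bar>
        \<le> q * (q ^ Suc k * D)"
      unfolding q_def
      by (rule half_step_lipschitz) (use \<tau>_pos \<eta>_pos IH True in \<open>auto simp: q_def\<close>)
    then show ?thesis using uv vs_eq IH True by (simp add: mult.assoc)
  next
    case False
    then have uv: "v = v'" "u = half_step C a \<tau> \<eta> v'"
      using Suc.prems sinkhorn_Suc_half_step[OF s] by (auto simp del: sinkhorn.simps)
    have "\<bar>half_step C a \<tau> \<eta> v' $ i - half_step C a \<tau> \<eta> vs $ i\<bar> \<le> q * (q ^ Suc k * D)"
      unfolding q_def
      by (rule half_step_lipschitz) (use \<tau>_pos \<eta>_pos IH False in \<open>auto simp: q_def\<close>)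
    then show ?thesis using uv us_eq IH False by (simp add: mult.assoc)
  qed
qed

lemma sinkhorn_dist_le:
  fixes D :: real
  assumes D: "\<And>i. \<bar>us $ i\<bar> \<le> D" "\<And>j. \<bar>vs $ j\<bar> \<le> D"
  assumes k: "sinkhorn C a b \<tau> \<eta> k = (u, v)"
  shows "\<bar>u $ i - us $ i\<bar> \<le> (\<tau> / (\<eta> + \<tau>)) ^ (k - 1) * D"
    and "\<bar>v $ j - vs $ j\<bar> \<le> (\<tau> / (\<eta> + \<tau>)) ^ (k - 1) * D"
proof -
  define q where "q = \<tau> / (\<eta> + \<tau>)"
  have q: "0 \<le> q" "q \<le> 1" using \<tau>_pos \<eta>_pos by (auto simp: q_def)
  have "0 \<le> D" using D(1)[of undefined] by linarith
  then have "q ^ Suc m * D \<le> q ^ m * D" for m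
    using q by (intro mult_right_mono power_decreasing) auto
  note this[of "k - 1"]
  moreover have "\<bar>u $ i - us $ i\<bar> \<le> q ^ (if even (k - 1) then Suc (k - 1) else k - 1) * D
    \<and> \<bar>v $ j - vs $ j\<bar> \<le> q ^ (if even (k - 1) then k - 1 else Suc (k - 1)) * D" if "k \<noteq> 0"
    unfolding q_def by (rule sinkhorn_Suc_dist_le) (use that D k in auto)
  ultimately have "\<bar>u $ i - us $ i\<bar> \<le> q ^ (k - 1) * D \<and> \<bar>v $ j - vs $ j\<bar> \<le> q ^ (k - 1) * D"
    if "k \<noteq> 0"
    using that by (auto split: if_splits simp del: power_Suc)
  \<comment> \<open>At k = 0 the exponent truncates to 0 and both iterates vanish, so the claim is
    the bound on the fixed point itself.\<close>
  moreover have "\<bar>u $ i - us $ i\<bar> \<le> q ^ (k - 1) * D \<and> \<bar>v $ j - vs $ j\<bar> \<le> q ^ (k - 1) * D"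
    if "k = 0"
    using that k D by auto
  ultimately show "\<bar>u $ i - us $ i\<bar> \<le> (\<tau> / (\<eta> + \<tau>)) ^ (k - 1) * D"
    and "\<bar>v $ j - vs $ j\<bar> \<le> (\<tau> / (\<eta> + \<tau>)) ^ (k - 1) * D"
    unfolding q_def by blast+
qed

end

section \<open>Iteration count and final estimate\<close>

text \<open>For \<open>W \<le> 1\<close> the last hypothesis admits \<open>k = 0\<close>, where the exponent truncates to 0.\<close>
lemma contraction_power_le_inverse:
  fixes \<tau> \<eta> W :: real
  assumes "0 < \<tau>" "0 < \<eta>" "0 < W" "1 + (\<tau> / \<eta> + 1) * ln W \<le> real k"
  shows "(\<tau> / (\<eta> + \<tau>)) ^ (k - 1) * W \<le> 1"
proof (cases "W \<le> 1")
  case True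
  have "(\<tau> / (\<eta> + \<tau>)) ^ (k - 1) \<le> 1" using assms by (intro power_le_one) auto
  then show ?thesis using True assms by (intro mult_le_one) auto
next
  case False
  let ?q = "\<tau> / (\<eta> + \<tau>)"
  have q: "0 < ?q" using assms by simp
  have W: "0 < ln W" using False by simp
  have "0 < (\<tau> / \<eta> + 1) * ln W" using W assms by (intro mult_pos_pos add_pos_pos) auto
  then have k: "(\<tau> / \<eta> + 1) * ln W \<le> real (k - 1)" using assms(4) by (simp add: of_nat_diff)
  \<comment> \<open>Each step gains at least \<eta>/(\<eta> + \<tau>) in the logarithm, the
    reciprocal of \<tau>/\<eta> + 1, so k - 1 steps gain at least \<open>ln W\<close>.\<close>
  have "ln ?q \<le> ?q - 1" using q by (rule ln_le_minus_one)
  also have "?q - 1 = - (\<eta> / (\<eta> + \<tau>))" using assms by (simp add: field_simps)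
  finally have "real (k - 1) * ln ?q \<le> real (k - 1) * - (\<eta> / (\<eta> + \<tau>))"
    by (intro mult_left_mono) auto
  also have "(\<tau> / \<eta> + 1) * ln W * (\<eta> / (\<eta> + \<tau>)) \<le> real (k - 1) * (\<eta> / (\<eta> + \<tau>))"
    using k assms by (intro mult_right_mono) auto
  moreover have "(\<tau> / \<eta> + 1) * ln W * (\<eta> / (\<eta> + \<tau>)) = ln W"
  proof -
    have "\<tau> / \<eta> + 1 = (\<eta> + \<tau>) / \<eta>" using assms by (simp add: field_simps)
    then show ?thesis using assms by simp
  qed
  ultimately have "real (k - 1) * ln ?q + ln W \<le> 0" by simp
  moreover have "ln (?q ^ (k - 1) * W) = real (k - 1) * ln ?q + ln W"
    using q assms by (subst ln_mult_pos) (auto simp: ln_realpow)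
  moreover have "0 < ?q ^ (k - 1) * W" using q assms by simp
  ultimately show ?thesis by (metis ln_le_zero_iff)
qed

theorem theorem2:
  fixes a b :: "real^'n" and C Xhat :: "real^'n^'n"
    and \<alpha> \<beta> \<tau> \<epsilon> U \<eta> R :: real and u v :: "nat \<Rightarrow> real^'n" and k :: nat
  assumes "CARD('n) \<ge> 2"
    and "\<And>i. a $ i > 0" and "\<And>j. b $ j > 0"
    and "\<alpha> = (\<Sum>i\<in>UNIV. a $ i)" and "\<beta> = (\<Sum>j\<in>UNIV. b $ j)"
    and "\<And>i j. C $ i $ j \<ge> 0"
    and "\<tau> > 0" and "\<epsilon> > 0"
    and "U = U_const CARD('n) \<alpha> \<beta> \<tau> \<epsilon>"
    and "\<eta> = \<epsilon> / U"
    and "R = R_const C a b \<eta>"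
    and "\<And>m. (u m, v m) = sinkhorn C a b \<tau> \<eta> m"
    and "is_arg_min (uot_objective C a b \<tau>) nonneg_mat Xhat"
    and "real k \<ge> 1 + (\<tau> * U / \<epsilon> + 1) *
           (ln (8 * \<eta> * R) + ln (\<tau> * (\<tau> + 1)) + 3 * ln (U / \<epsilon>))"
  shows "uot_objective C a b \<tau> (sinkhorn_plan C \<eta> (u k) (v k))
           \<le> uot_objective C a b \<tau> Xhat + \<epsilon>"
proof -
  let ?L = "ln (real CARD('n))"
  let ?ST = "S_const CARD('n) \<alpha> \<beta> + T_const CARD('n) \<alpha> \<beta>"
  \<comment> \<open>In this order, the members of the maximum give the final error bound \<epsilon>,
    \<eta> \<le> 1/2, and the two smallness conditions on \<eta> relative to \<tau>.\<close>
  have U: "?ST \<le> U" "2 * \<epsilon> \<le> U" "4 * \<epsilon> * ?L / \<tau> \<le> U" "4 * \<epsilon> * (\<alpha> + \<beta>) * ?L / \<tau> \<le> U"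
    unfolding assms(9) U_const_def by (intro Max_ge; simp)+
  have U0: "0 < U" using U(2) \<open>0 < \<epsilon>\<close> by linarith
  then have \<eta>: "0 < \<eta>" and \<eta>U: "\<eta> * U = \<epsilon>" using \<open>0 < \<epsilon>\<close> by (auto simp: assms(10))
  have \<eta>_half: "\<eta> \<le> 1 / 2" using U(2) U0 by (simp add: assms(10) field_simps)
  have \<eta>L: "\<eta> * ?L \<le> \<tau> / 4" "\<eta> * (\<alpha> + \<beta>) * ?L \<le> \<tau> / 4"
    using U(3,4) U0 \<open>0 < \<tau>\<close> by (simp_all add: assms(10) field_simps)
  interpret unbalanced_ot C a b \<tau> by unfold_locales (use assms in auto)
  obtain us vs where uvs: "us = half_step C a \<tau> \<eta> vs" "vs = half_step (transpose C) b \<tau> \<eta> us"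
    and us: "\<And>i. \<bar>us $ i\<bar> \<le> \<tau> * R" and vs: "\<And>j. \<bar>vs $ j\<bar> \<le> \<tau> * R"
    using half_step_fixpoint_exists[OF \<eta>] unfolding assms(11) by metis
  interpret sinkhorn_fixpoint C a b \<tau> \<eta> us vs by unfold_locales (use \<eta> uvs in auto)
  have "0 < ?L" using assms(1) by simp
  then have R: "0 < R"
    using infnorm_pos_le[of "vlog a"] unfolding assms(11) R_const_def by linarith
  \<comment> \<open>\<open>W\<close> is the initial error bound \<open>\<tau> * R\<close> divided by
    the required accuracy \<eta>^2/(8(\<tau> + 1)); since U/\<epsilon> = 1/\<eta>, the logarithms in
    the iteration bound add up to \<open>ln W\<close>.\<close>
  define W where "W = 8 * R * \<tau> * (\<tau> + 1) / \<eta>\<^sup>2"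
  have W: "0 < W" using R \<open>0 < \<tau>\<close> \<eta> by (simp add: W_def)
  have "ln (8 * \<eta> * R) + ln (\<tau> * (\<tau> + 1)) + 3 * ln (U / \<epsilon>)
      = ln (8 * \<eta> * R * (\<tau> * (\<tau> + 1)) * (U / \<epsilon>) ^ 3)"
    using R \<eta> \<open>0 < \<tau>\<close> U0 \<open>0 < \<epsilon>\<close> by (simp add: ln_mult_pos ln_realpow)
  also have "U / \<epsilon> = 1 / \<eta>" by (simp add: assms(10))
  also have "8 * \<eta> * R * (\<tau> * (\<tau> + 1)) * (1 / \<eta>) ^ 3 = W"
    using \<eta> by (simp add: W_def power2_eq_square power3_eq_cube field_simps)
  finally have lnW: "ln (8 * \<eta> * R) + ln (\<tau> * (\<tau> + 1)) + 3 * ln (U / \<epsilon>) = ln W"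
    by (simp add: assms(10))
  have "\<tau> * U / \<epsilon> = \<tau> / \<eta>" by (simp add: assms(10))
  then have "1 + (\<tau> / \<eta> + 1) * ln W \<le> real k" using assms(14) lnW by simp
  then have "(\<tau> / (\<eta> + \<tau>)) ^ (k - 1) * W \<le> 1"
    by (intro contraction_power_le_inverse \<open>0 < \<tau>\<close> \<eta> W)
  then have d: "(\<tau> / (\<eta> + \<tau>)) ^ (k - 1) * (\<tau> * R) \<le> \<eta>\<^sup>2 / (8 * (\<tau> + 1))"
    using \<eta> \<open>0 < \<tau>\<close> unfolding W_def by (simp add: pos_le_divide_eq pos_divide_le_eq mult_ac)
  have "uot_objective C a b \<tau> (sinkhorn_plan C \<eta> (u k) (v k)) \<le> uot_objective C a b \<tau> Xhat + \<eta> * ?ST"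
    unfolding assms(4,5)
  proof (rule objective_le_of_close_potentials[OF assms(1) \<eta>_half _ _ _ _ d assms(13)])
    show "\<eta> * ?L \<le> \<tau> / 4" "\<eta> * total * ?L \<le> \<tau> / 4"
      using \<eta>L unfolding assms(4,5) by auto
  qed (rule sinkhorn_dist_le[OF us vs assms(12)[symmetric]])+
  also have "\<eta> * ?ST \<le> \<epsilon>" using U(1) \<eta> \<eta>U by (metis mult_left_mono less_imp_le)
  finally show ?thesis by simp
qed

end
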